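(* Let $d\ge 3$ be an integer and let $$P(X)=X^{d-3}\cdot(X-i)\cdot(X-j)\cdot(X-k)\in\mathbb{H}[X].$$ Then $N(P)(X)=X^{2d-6}\cdot(X^2+1)^3$, and $N(P')$ contains a unique monomial of odd degree, namely $-4X^{2d-5}$. In particular, $P$ is not a Gauss-Lucas polynomial.
   Context: $\mathbb{H}$ denotes the real algebra of quaternions with standard basis $1,i,j,k$ (so $i^2=j^2=k^2=-1$, $ij=k=-ji$). $\mathbb{H}[X]$ is the ring of quaternionic polynomials $P(X)=\sum_{h=0}^d X^h a_h$ with coefficients $a_h\in\mathbb{H}$ written on the right; the product $P\cdot Q$ is defined by letting $X$ commute with the coefficients, i.e. $(\sum_h X^h a_h)\cdot(\sum_l X^l b_l)=\sum_{h,l}X^{h+l}a_hb_l$. The value of $P$ at $x\in\mathbb{H}$ is $P(x)=\sum_{h=0}^d x^h a_h$, and $V(P)=\{x\in\mathbb{H}\mid P(x)=0\}$. The derivative is $P'(X)=\sum_{h=1}^d X^{h-1}h a_h$. Set $P^c(X)=\sum_{h=0}^d X^h\bar a_h$ (quaternionic conjugates of the coefficients) and $N(P)=P\cdot P^c=P^c\cdot P$, the normal polynomial of $P$, which has real coefficients. Let $\mathcal{K}(N(P))$ denote the convex hull in $\mathbb{H}\cong\mathbb{R}^4$ of $V(N(P))\subset\mathbb{H}$. A polynomial $P\in\mathbb{H}[X]$ of degree $\ge 2$ is called a Gauss-Lucas polynomial if $V(P')\subset\mathcal{K}(N(P))$. *)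

theory Defs
  imports "HOL-Analysis.Analysis" "HOL-Library.Poly_Mapping"
begin

datatype quat = Quat (qRe: real) (qIm1: real) (qIm2: real) (qIm3: real)

instantiation quat :: real_vector
begin

definition "0 = Quat 0 0 0 0"

definition "x + y = Quat (qRe x + qRe y) (qIm1 x + qIm1 y) (qIm2 x + qIm2 y) (qIm3 x + qIm3 y)"

definition "- x = Quat (- qRe x) (- qIm1 x) (- qIm2 x) (- qIm3 x)"

definition "x - y = Quat (qRe x - qRe y) (qIm1 x - qIm1 y) (qIm2 x - qIm2 y) (qIm3 x - qIm3 y)"

definition "r *\<^sub>R x = Quat (r * qRe x) (r * qIm1 x) (r * qIm2 x) (r * qIm3 x)"

instance
  by standard
    (auto simp: zero_quat_def plus_quat_def uminus_quat_def minus_quat_def scaleR_quat_def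
      algebra_simps)

end

definition qcnj :: "quat \<Rightarrow> quat" where
  "qcnj x = Quat (qRe x) (- qIm1 x) (- qIm2 x) (- qIm3 x)"

instantiation quat :: real_div_algebra
begin

definition "1 = Quat 1 0 0 0"

definition "x * y = Quat
  (qRe x * qRe y - qIm1 x * qIm1 y - qIm2 x * qIm2 y - qIm3 x * qIm3 y)
  (qRe x * qIm1 y + qIm1 x * qRe y + qIm2 x * qIm3 y - qIm3 x * qIm2 y)
  (qRe x * qIm2 y - qIm1 x * qIm3 y + qIm2 x * qRe y + qIm3 x * qIm1 y)
  (qRe x * qIm3 y + qIm1 x * qIm2 y - qIm2 x * qIm1 y + qIm3 x * qRe y)"

definition "inverse x =
  inverse ((qRe x)\<^sup>2 + (qIm1 x)\<^sup>2 + (qIm2 x)\<^sup>2 + (qIm3 x)\<^sup>2) *\<^sub>R qcnj x"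

definition "x div y = x * inverse y" for x y :: quat

instance
proof
  fix x :: quat
  let ?n = "(qRe x)\<^sup>2 + (qIm1 x)\<^sup>2 + (qIm2 x)\<^sup>2 + (qIm3 x)\<^sup>2"
  assume "x \<noteq> 0"
  then have "?n \<noteq> 0"
    by (cases x) (auto simp: zero_quat_def add_nonneg_eq_0_iff)
  then have n: "inverse ?n * ?n = 1"
    by simp
  show "inverse x * x = 1" "x * inverse x = 1"
    using n
    by (auto simp: inverse_quat_def qcnj_def times_quat_def one_quat_def scaleR_quat_def
        power2_eq_square algebra_simps)
qed (auto simp: zero_quat_def one_quat_def plus_quat_def times_quat_def scaleR_quat_def
    inverse_quat_def divide_quat_def qcnj_def algebra_simps)

end

definition qi :: quat where "qi = Quat 0 1 0 0"

definition qj :: quat where "qj = Quat 0 0 1 0"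

definition qk :: quat where "qk = Quat 0 0 0 1"

lemma quat_units:
  "qi * qi = - 1" "qj * qj = - 1" "qk * qk = - 1" "qi * qj = qk" "qj * qi = - qk"
  by (simp_all add: qi_def qj_def qk_def times_quat_def one_quat_def uminus_quat_def)

text \<open>
  The library type \<open>nat \<Rightarrow>\<^sub>0 quat\<close> of finitely supported coefficient functions has convolution
  as its product, so it is the ring of quaternionic polynomials in a central indeterminate.
  (The type constructor \<open>poly\<close> has a product only over commutative coefficients.)
\<close>

type_synonym qpoly = "nat \<Rightarrow>\<^sub>0 quat"

definition qX :: qpoly where
  "qX = Poly_Mapping.single 1 1"

definition qconst :: "quat \<Rightarrow> qpoly" where
  "qconst a = Poly_Mapping.single 0 a"

text \<open>
  \<open>Poly_Mapping.degree\<close> is one more than the usual degree for nonzero polynomials, and 0 for the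
  zero polynomial.
\<close>

definition qdegree :: "qpoly \<Rightarrow> nat" where
  "qdegree P = Poly_Mapping.degree P - 1"

definition qeval :: "qpoly \<Rightarrow> quat \<Rightarrow> quat" where
  "qeval P x = (\<Sum>h\<le>qdegree P. x ^ h * Poly_Mapping.lookup P h)"

definition qzeros :: "qpoly \<Rightarrow> quat set" where
  "qzeros P = {x. qeval P x = 0}"

definition qderiv :: "qpoly \<Rightarrow> qpoly" where
  "qderiv P =
    (\<Sum>h=1..qdegree P. Poly_Mapping.single (h - 1) (of_nat h * Poly_Mapping.lookup P h))"

definition conj_poly :: "qpoly \<Rightarrow> qpoly" where
  "conj_poly P = Poly_Mapping.map qcnj P"

definition normal_poly :: "qpoly \<Rightarrow> qpoly" where
  "normal_poly P = P * conj_poly P"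

definition gauss_lucas_poly :: "qpoly \<Rightarrow> bool" where
  "gauss_lucas_poly P \<longleftrightarrow>
    2 \<le> qdegree P \<and> qzeros (qderiv P) \<subseteq> convex hull (qzeros (normal_poly P))"

end

(* Expanding the product gives N(P') with the single odd term - 4 X ^ (2 d - 5). After removing the
   power of X dividing it, N(P') has a complex root z, and Re z is nonzero: at a purely imaginary
   point i y, the imaginary part of N(P') comes from the odd term alone, so it vanishes only at y = 0.
   Some quaternionic zero of P' has the same real part as z. But V(N(P)) consists of unit imaginary
   quaternions and possibly 0, so its convex hull lies in the hyperplane of real part 0. *)

theory Submission
  imports Defs "HOL-Computational_Algebra.Fundamental_Theorem_Algebra"
begin

section \<open>Coordinates and conjugation of quaternions\<close>

lemma qRe_simps [simp]:
  "qRe 0 = 0" "qRe 1 = 1" "qRe (x + y) = qRe x + qRe y" "qRe (x - y) = qRe x - qRe y"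
  "qRe (- x) = - qRe x" "qRe (r *\<^sub>R x) = r * qRe x" "qRe (of_nat n) = real n"
  by (simp_all add: zero_quat_def one_quat_def plus_quat_def minus_quat_def uminus_quat_def
      scaleR_quat_def)
    (induction n, simp_all add: zero_quat_def one_quat_def plus_quat_def)

lemma qIm_simps [simp]:
  "qIm1 0 = 0" "qIm1 1 = 0" "qIm1 (x + y) = qIm1 x + qIm1 y" "qIm1 (x - y) = qIm1 x - qIm1 y"
  "qIm1 (- x) = - qIm1 x" "qIm1 (r *\<^sub>R x) = r * qIm1 x"
  "qIm2 0 = 0" "qIm2 1 = 0" "qIm2 (x + y) = qIm2 x + qIm2 y" "qIm2 (x - y) = qIm2 x - qIm2 y"
  "qIm2 (- x) = - qIm2 x" "qIm2 (r *\<^sub>R x) = r * qIm2 x"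
  "qIm3 0 = 0" "qIm3 1 = 0" "qIm3 (x + y) = qIm3 x + qIm3 y" "qIm3 (x - y) = qIm3 x - qIm3 y"
  "qIm3 (- x) = - qIm3 x" "qIm3 (r *\<^sub>R x) = r * qIm3 x"
  by (simp_all add: zero_quat_def one_quat_def plus_quat_def minus_quat_def uminus_quat_def
      scaleR_quat_def)

lemma q_times_simps [simp]:
  "qRe (x * y) = qRe x * qRe y - qIm1 x * qIm1 y - qIm2 x * qIm2 y - qIm3 x * qIm3 y"
  "qIm1 (x * y) = qRe x * qIm1 y + qIm1 x * qRe y + qIm2 x * qIm3 y - qIm3 x * qIm2 y"
  "qIm2 (x * y) = qRe x * qIm2 y - qIm1 x * qIm3 y + qIm2 x * qRe y + qIm3 x * qIm1 y"
  "qIm3 (x * y) = qRe x * qIm3 y + qIm1 x * qIm2 y - qIm2 x * qIm1 y + qIm3 x * qRe y"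
  by (simp_all add: times_quat_def)

lemma qcnj_simps [simp]:
  "qRe (qcnj x) = qRe x" "qIm1 (qcnj x) = - qIm1 x" "qIm2 (qcnj x) = - qIm2 x"
  "qIm3 (qcnj x) = - qIm3 x"
  by (simp_all add: qcnj_def)

lemma qcnj_zero [simp]: "qcnj 0 = 0"
  by (simp add: qcnj_def zero_quat_def)

lemma qcnj_add: "qcnj (x + y) = qcnj x + qcnj y"
  by (simp add: qcnj_def plus_quat_def)

lemma qIm_of_nat [simp]: "qIm1 (of_nat n) = 0" "qIm2 (of_nat n) = 0" "qIm3 (of_nat n) = 0"
  by (induction n) simp_all

lemma q_numeral [simp]:
  "qRe (numeral w) = numeral w" "qIm1 (numeral w) = 0" "qIm2 (numeral w) = 0"
  "qIm3 (numeral w) = 0"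
  by (metis of_nat_numeral qRe_simps(7)) (metis of_nat_numeral qIm_of_nat)+

lemma numeral_eq_Quat: "numeral w = Quat (numeral w) 0 0 0"
  by (rule quat.expand) simp

lemma quat_eq_iff:
  "x = y \<longleftrightarrow> qRe x = qRe y \<and> qIm1 x = qIm1 y \<and> qIm2 x = qIm2 y \<and> qIm3 x = qIm3 y"
  by (cases x; cases y) simp

text \<open>The real part is the sum of the squares of the four coordinates; it serves as the
  squared norm below.\<close>

lemma qRe_mult_qcnj_eq_0_iff: "qRe (x * qcnj x) = 0 \<longleftrightarrow> x = 0"
  by (simp add: quat_eq_iff add_nonneg_eq_0_iff conj_assoc)

section \<open>Coefficients, values, derivatives and normal polynomials\<close>

lemma lookup_conj_poly: "Poly_Mapping.lookup (conj_poly P) n = qcnj (Poly_Mapping.lookup P n)"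
  unfolding conj_poly_def by (simp add: Poly_Mapping.map.rep_eq when_def)

lemma conj_poly_add: "conj_poly (P + Q) = conj_poly P + conj_poly Q"
  by (rule poly_mapping_eqI) (simp add: lookup_conj_poly lookup_add qcnj_add)

lemma conj_poly_single: "conj_poly (Poly_Mapping.single n a) = Poly_Mapping.single n (qcnj a)"
  by (rule poly_mapping_eqI) (simp add: lookup_conj_poly lookup_single when_def)

lemma keys_subset_qdegree: "Poly_Mapping.keys P \<subseteq> {..qdegree P}"
  using in_keys_less_degree[of _ P] by (fastforce simp: qdegree_def)

text \<open>Freedom in the index set lets two polynomials and their sum, whose degree may drop, be
  evaluated over the same exponents.\<close>

lemma qeval_eq_sum:
  assumes "finite S" "Poly_Mapping.keys P \<subseteq> S"
  shows "qeval P x = (\<Sum>h\<in>S. x ^ h * Poly_Mapping.lookup P h)"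
proof -
  have "qeval P x = (\<Sum>h\<in>Poly_Mapping.keys P. x ^ h * Poly_Mapping.lookup P h)"
    unfolding qeval_def
    by (rule sum.mono_neutral_right) (use keys_subset_qdegree[of P] in \<open>auto simp: in_keys_iff\<close>)
  also have "\<dots> = (\<Sum>h\<in>S. x ^ h * Poly_Mapping.lookup P h)"
    by (rule sum.mono_neutral_left) (use assms in \<open>auto simp: in_keys_iff\<close>)
  finally show ?thesis .
qed

lemma qeval_add: "qeval (P + Q) x = qeval P x + qeval Q x"
proof -
  let ?S = "Poly_Mapping.keys P \<union> Poly_Mapping.keys Q"
  have *: "finite ?S" by simp
  show ?thesis
    using qeval_eq_sum[OF *, of "P + Q" x] qeval_eq_sum[OF *, of P x] qeval_eq_sum[OF *, of Q x]
      keys_add[of P Q]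
    by (simp add: lookup_add distrib_left sum.distrib)
qed

lemma qeval_single: "qeval (Poly_Mapping.single n a) x = x ^ n * a"
  using qeval_eq_sum[of "{n}" "Poly_Mapping.single n a" x] by simp

lemma lookup_qderiv:
  "Poly_Mapping.lookup (qderiv P) n = of_nat (Suc n) * Poly_Mapping.lookup P (Suc n)"
proof -
  have "Poly_Mapping.lookup (qderiv P) n =
      (\<Sum>h=1..qdegree P. if h = Suc n then of_nat h * Poly_Mapping.lookup P h else 0)"
    unfolding qderiv_def lookup_sum
    by (intro sum.cong) (auto simp: lookup_single when_def)
  also have "\<dots> = of_nat (Suc n) * Poly_Mapping.lookup P (Suc n)"
    using keys_subset_qdegree[of P]
    by (simp add: sum.delta in_keys_iff subset_iff del: of_nat_Suc) (metis mult_zero_right)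
  finally show ?thesis .
qed

lemma qderiv_add: "qderiv (P + Q) = qderiv P + qderiv Q"
  by (rule poly_mapping_eqI) (simp add: lookup_qderiv lookup_add distrib_left del: of_nat_Suc)

text \<open>For \<open>n = 0\<close> the truncated exponent \<open>n - 1\<close> is harmless, as the
  coefficient is then 0.\<close>

lemma qderiv_single:
  "qderiv (Poly_Mapping.single n a) = Poly_Mapping.single (n - 1) (of_nat n * a)"
  by (rule poly_mapping_eqI)
    (cases n; auto simp: lookup_qderiv lookup_single when_def simp del: of_nat_Suc)

lemma qX_power: "qX ^ n = Poly_Mapping.single n 1"
  by (induction n) (simp_all add: qX_def mult_single)

text \<open>Both P and P' have this shape, so a single computation of the normal polynomial serves
  for both. The leading coefficient may be 0.\<close>

definition cubic :: "nat \<Rightarrow> quat \<Rightarrow> quat \<Rightarrow> quat \<Rightarrow> quat \<Rightarrow> qpoly" where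
  "cubic n a b c e = Poly_Mapping.single (n + 3) a + Poly_Mapping.single (n + 2) b
    + Poly_Mapping.single (n + 1) c + Poly_Mapping.single n e"

lemma normal_poly_cubic:
  "normal_poly (cubic n a b c e) =
    Poly_Mapping.single (2 * n + 6) (a * qcnj a) +
    Poly_Mapping.single (2 * n + 5) (a * qcnj b + b * qcnj a) +
    Poly_Mapping.single (2 * n + 4) (a * qcnj c + b * qcnj b + c * qcnj a) +
    Poly_Mapping.single (2 * n + 3) (a * qcnj e + b * qcnj c + c * qcnj b + e * qcnj a) +
    Poly_Mapping.single (2 * n + 2) (b * qcnj e + c * qcnj c + e * qcnj b) +
    Poly_Mapping.single (2 * n + 1) (c * qcnj e + e * qcnj c) +
    Poly_Mapping.single (2 * n) (e * qcnj e)"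
proof -
  have exps: "n + 3 + (n + 3) = 2 * n + 6" "n + 3 + (n + 2) = 2 * n + 5"
    "n + 3 + (n + 1) = 2 * n + 4" "n + 3 + n = 2 * n + 3" "n + 2 + (n + 3) = 2 * n + 5"
    "n + 2 + (n + 2) = 2 * n + 4" "n + 2 + (n + 1) = 2 * n + 3" "n + 2 + n = 2 * n + 2"
    "n + 1 + (n + 3) = 2 * n + 4" "n + 1 + (n + 2) = 2 * n + 3" "n + 1 + (n + 1) = 2 * n + 2"
    "n + 1 + n = 2 * n + 1" "n + (n + 3) = 2 * n + 3" "n + (n + 2) = 2 * n + 2"
    "n + (n + 1) = 2 * n + 1" "n + n = 2 * n" by simp_all
  show ?thesis
    \<comment> \<open>Here \<open>single_add\<close> splits the right-hand side into the sixteen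
      monomials of the product, so only their order remains to be matched.\<close>
    by (simp only: normal_poly_def cubic_def conj_poly_add conj_poly_single distrib_left
        distrib_right mult_single single_add exps) (simp only: ac_simps)
qed

section \<open>From complex zeros of a normal polynomial to quaternionic zeros\<close>

text \<open>
  The coefficients of the remainder of \<open>X ^ n\<close> modulo \<open>X\<^sup>2 - s X + r\<close>.
\<close>

fun power_rem :: "real \<Rightarrow> real \<Rightarrow> nat \<Rightarrow> real \<times> real" where
  "power_rem s r 0 = (0, 1)"
| "power_rem s r (Suc n) = (s * fst (power_rem s r n) + snd (power_rem s r n),
     - r * fst (power_rem s r n))"

text \<open>The coefficients depend only on s and r, so a complex number and a quaternion satisfying
  the same real quadratic equation share them.\<close>

lemma power_eq_power_rem:
  fixes x :: "'a::real_algebra_1"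
  assumes "x * x = s *\<^sub>R x - r *\<^sub>R 1"
  shows "x ^ n = fst (power_rem s r n) *\<^sub>R x + snd (power_rem s r n) *\<^sub>R 1"
  by (induction n) (simp_all add: assms algebra_simps)

text \<open>This is the characteristic equation of x, with trace \<open>2 * qRe x\<close> and the
  squared norm as constant term.\<close>

lemma quat_square: "x * x = (2 * qRe x) *\<^sub>R x - qRe (x * qcnj x) *\<^sub>R 1"
  by (simp add: quat_eq_iff algebra_simps)

lemma complex_square: "z * z = (2 * Re z) *\<^sub>R z - ((Re z)\<^sup>2 + (Im z)\<^sup>2) *\<^sub>R 1"
  by (simp add: complex_eq_iff algebra_simps power2_eq_square)

text \<open>The form \<open>qRe (a * qcnj b)\<close> is the Euclidean inner product, hence real
  bilinear.\<close>

lemma qRe_mult_qcnj_sums: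
  "qRe ((\<Sum>m\<in>S. u m *\<^sub>R a m) * qcnj (\<Sum>n\<in>T. v n *\<^sub>R b n))
    = (\<Sum>m\<in>S. \<Sum>n\<in>T. u m * v n * qRe (a m * qcnj (b n)))"
proof -
  have s: "qRe (sum f A) = (\<Sum>n\<in>A. qRe (f n))" "qIm1 (sum f A) = (\<Sum>n\<in>A. qIm1 (f n))"
    "qIm2 (sum f A) = (\<Sum>n\<in>A. qIm2 (f n))" "qIm3 (sum f A) = (\<Sum>n\<in>A. qIm3 (f n))"
    for f :: "'c \<Rightarrow> quat" and A
    by (induction A rule: infinite_finite_induct; simp)+
  show ?thesis
    by (simp add: s sum_product sum.distrib[symmetric] algebra_simps)
qed

text \<open>
  The left-hand side of the assumption is the value at \<open>z\<close> of the normal polynomial of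
  \<open>\<Sum>n\<in>S. X ^ n * a n\<close>. On the sphere of quaternions with the real part and the norm of \<open>z\<close>, all
  powers are real affine functions of \<open>x\<close>, so there the polynomial agrees with some
  \<open>x * \<alpha> + \<beta>\<close>, and the same coefficients represent the normal polynomial at \<open>z\<close>.
\<close>

lemma quaternionic_zero_of_normal_zero:
  fixes a :: "nat \<Rightarrow> quat" and z :: complex
  assumes "(\<Sum>m\<in>S. \<Sum>n\<in>S. of_real (qRe (a m * qcnj (a n))) * z ^ (m + n)) = 0"
  obtains x where "qRe x = Re z" "(\<Sum>n\<in>S. x ^ n * a n) = 0"
proof -
  define s r where "s = 2 * Re z" and "r = (Re z)\<^sup>2 + (Im z)\<^sup>2"
  define u v where "u n = fst (power_rem s r n)" and "v n = snd (power_rem s r n)" for n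
  define \<alpha> \<beta> where "\<alpha> = (\<Sum>n\<in>S. u n *\<^sub>R a n)" and "\<beta> = (\<Sum>n\<in>S. v n *\<^sub>R a n)"
  \<comment> \<open>The normal polynomial of \<open>X * \<alpha> + \<beta>\<close> is
    \<open>A * X^2 + 2 * B * X + C\<close>.\<close>
  define A B C where "A = qRe (\<alpha> * qcnj \<alpha>)" and "B = qRe (\<alpha> * qcnj \<beta>)" and "C = qRe (\<beta> * qcnj \<beta>)"
  have B': "qRe (\<beta> * qcnj \<alpha>) = B"
    by (simp add: B_def algebra_simps)
  have zp: "z ^ n = u n *\<^sub>R z + v n *\<^sub>R 1" for n
    unfolding u_def v_def by (rule power_eq_power_rem) (simp add: s_def r_def complex_square)
  have xp: "(\<Sum>n\<in>S. x ^ n * a n) = x * \<alpha> + \<beta>" if "qRe x = Re z" "qRe (x * qcnj x) = r" for x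
  proof -
    have "x ^ n = u n *\<^sub>R x + v n *\<^sub>R 1" for n
      unfolding u_def v_def
      by (rule power_eq_power_rem) (use that quat_square[of x] in \<open>simp add: s_def\<close>)
    then show ?thesis
      by (simp add: \<alpha>_def \<beta>_def sum_distrib_left distrib_right sum.distrib)
  qed
  have "(\<Sum>m\<in>S. \<Sum>n\<in>S. of_real (qRe (a m * qcnj (a n))) * z ^ (m + n))
      = (\<Sum>m\<in>S. \<Sum>n\<in>S. of_real (u m * u n * qRe (a m * qcnj (a n))) * (z * z)
          + of_real (u m * v n * qRe (a m * qcnj (a n)) + v m * u n * qRe (a m * qcnj (a n))) * z
          + of_real (v m * v n * qRe (a m * qcnj (a n))))"
    unfolding power_add zp
    by (simp add: scaleR_conv_of_real algebra_simps power2_eq_square del: q_times_simps)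
  also have "\<dots> = of_real A * (z * z) + of_real (B + B) * z + of_real C"
    unfolding A_def C_def
    by (subst (2) B'[symmetric], unfold B_def \<alpha>_def \<beta>_def qRe_mult_qcnj_sums)
      (simp only: sum.distrib sum_distrib_right of_real_sum of_real_add distrib_right)
  finally have "of_real A * (z * z) + of_real (B + B) * z + of_real C = 0"
    using assms by simp
  then have re: "A * ((Re z)\<^sup>2 - (Im z)\<^sup>2) + 2 * B * Re z + C = 0"
    and im: "Im z * (A * Re z + B) = 0"
    by (simp_all add: complex_eq_iff power2_eq_square algebra_simps)
  show thesis
  proof (cases "Im z = 0")
    case True
    define x where "x = Quat (Re z) 0 0 0"
    \<comment> \<open>For real x the squared norm of \<open>x * \<alpha> + \<beta>\<close> is
      \<open>A * x^2 + 2 * B * x + C\<close>, which is 0 by \<open>re\<close>.\<close>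
    have "qRe ((x * \<alpha> + \<beta>) * qcnj (x * \<alpha> + \<beta>)) = 0"
      using re True
      by (simp add: A_def B_def C_def x_def algebra_simps power2_eq_square)
    then have "x * \<alpha> + \<beta> = 0"
      by (simp only: qRe_mult_qcnj_eq_0_iff)
    then show thesis
      using that[of x] xp[of x] True by (simp add: x_def r_def power2_eq_square)
  next
    case False
    \<comment> \<open>A non-real z and its conjugate are both roots of the real quadratic, which is
      therefore A times \<open>X^2 - s * X + r\<close>.\<close>
    then have B: "B = - A * Re z" using im by simp
    have C: "C = A * r" using re unfolding B r_def by (simp add: algebra_simps power2_eq_square)
    show thesis
    proof (cases "\<alpha> = 0")
      case True
      then have "\<beta> = 0"
        using C qRe_mult_qcnj_eq_0_iff[of \<beta>] by (simp add: A_def C_def)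
      then show thesis
        \<comment> \<open>With both coefficients 0, every point of the sphere is a zero; z itself,
          read as a quaternion, is chosen.\<close>
        using that[of "Quat (Re z) (Im z) 0 0"] xp[of "Quat (Re z) (Im z) 0 0"] True
        by (simp add: r_def power2_eq_square)
    next
      case False
      then have A: "A \<noteq> 0"
        unfolding A_def qRe_mult_qcnj_eq_0_iff by simp
      \<comment> \<open>This is the only solution of \<open>x * \<alpha> + \<beta> = 0\<close>. Its
        real part \<open>- B / A\<close> and squared norm \<open>C / A\<close> agree with those of
        z, so it lies on the sphere.\<close>
      define x where "x = - (\<beta> * qcnj \<alpha>) /\<^sub>R A"
      have "x * \<alpha> = - (inverse A *\<^sub>R (\<beta> * (qcnj \<alpha> * \<alpha>)))"
        by (simp add: x_def mult.assoc)
      also have "qcnj \<alpha> * \<alpha> = A *\<^sub>R 1"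
        by (simp add: quat_eq_iff A_def algebra_simps)
      finally have "x * \<alpha> + \<beta> = 0"
        using A by simp
      moreover have "qRe x = Re z"
        using A B B' by (simp add: x_def del: q_times_simps)
      moreover have "qRe (x * qcnj x) = r"
      proof -
        have "qRe (x * qcnj x) * A = qRe ((x * \<alpha>) * qcnj (x * \<alpha>))"
          by (simp add: A_def algebra_simps)
        also have "x * \<alpha> = - \<beta>" using \<open>x * \<alpha> + \<beta> = 0\<close> by (simp add: eq_neg_iff_add_eq_0)
        also have "qRe (- \<beta> * qcnj (- \<beta>)) = A * r"
          using C by (simp add: C_def)
        finally show ?thesis using A by simp
      qed
      ultimately show thesis using that[of x] xp[of x] by simp
    qed
  qed
qed

section \<open>The normal polynomials of P and P'\<close>

abbreviation ijk_poly :: "nat \<Rightarrow> qpoly" where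
  "ijk_poly n \<equiv> cubic n 1 (Quat 0 (- 1) (- 1) (- 1)) (Quat 0 1 (- 1) 1) 1"

text \<open>Since ij = k, ik = -j and jk = i, the coefficient ij + ik + jk is i - j + k, and -ijk =
  1.\<close>

lemma product_eq_ijk_poly:
  "qX ^ n * (qX - qconst qi) * (qX - qconst qj) * (qX - qconst qk) = ijk_poly n"
proof -
  have "qX - qconst a = Poly_Mapping.single 1 1 + Poly_Mapping.single 0 (- a)" for a
    by (simp add: qX_def qconst_def single_uminus)
  then have "qX ^ n * (qX - qconst qi) * (qX - qconst qj) * (qX - qconst qk)
    = cubic n 1 (- qi - qj - qk) (qi * qj + qi * qk + qj * qk) (- (qi * qj * qk))"
    by (simp only: cubic_def qX_power distrib_left distrib_right mult_single mult_1_left mult_1_right)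
      (simp add: single_add single_diff single_uminus eval_nat_numeral)
  then show ?thesis
    by (simp add: qi_def qj_def qk_def uminus_quat_def minus_quat_def plus_quat_def times_quat_def
        one_quat_def)
qed

text \<open>Needed in two rings: for \<open>qX\<close> it expands the polynomial, and for a
  quaternion it factors the value again, although evaluation is not multiplicative in
  general.\<close>

lemma power_times_square_plus_one_cubed:
  fixes x :: "'a::ring_1"
  shows "x ^ (2 * n) * (x ^ 2 + 1) ^ 3
    = x ^ (2 * n + 6) + 3 * x ^ (2 * n + 4) + 3 * x ^ (2 * n + 2) + x ^ (2 * n)"
proof -
  have *: "(x ^ 2 + 1) ^ 3 = x ^ 6 + x ^ 4 + x ^ 4 + x ^ 4 + x ^ 2 + x ^ 2 + x ^ 2 + 1"
    by (simp add: eval_nat_numeral algebra_simps)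
  have **: "3 * y = y + y + y" for y :: 'a
    using distrib_right[of "1 + 1" 1 y] by (simp add: mult_2)
  show ?thesis
    by (simp only: * ** power_add distrib_left mult_1_right add.assoc)
qed

lemma qX_expansion_eq_singles:
  "qX ^ (2 * n) * (qX ^ 2 + 1) ^ 3
    = Poly_Mapping.single (2 * n + 6) 1 + Poly_Mapping.single (2 * n + 4) 3
      + Poly_Mapping.single (2 * n + 2) 3 + Poly_Mapping.single (2 * n) 1"
proof -
  have "3 * Poly_Mapping.single k 1 = (Poly_Mapping.single k 3 :: qpoly)" for k
    by (metis single_numeral mult_single add_0 mult_1_right)
  then show ?thesis
    by (simp only: power_times_square_plus_one_cubed) (simp only: qX_power)
qed

lemma normal_poly_ijk_poly:
  "normal_poly (ijk_poly n) = qX ^ (2 * n) * (qX ^ 2 + 1) ^ 3"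
  unfolding normal_poly_cubic qX_expansion_eq_singles
  by (simp add: qcnj_def plus_quat_def times_quat_def one_quat_def
      zero_quat_def[symmetric] numeral_eq_Quat)

lemma qderiv_cubic:
  "qderiv (cubic n a b c e) = Poly_Mapping.single (n + 2) (of_nat (n + 3) * a) +
    Poly_Mapping.single (n + 1) (of_nat (n + 2) * b) + Poly_Mapping.single n (of_nat (n + 1) * c) +
    Poly_Mapping.single (n - 1) (of_nat n * e)"
  by (simp add: cubic_def qderiv_add qderiv_single del: of_nat_add)

text \<open>The imaginary parts (-1, -1, -1) and (1, -1, 1) have inner product -1, so the
  coefficient of \<open>X^(2n+1)\<close> is 2 (n (n + 3) - (n + 1) (n + 2)) = -4. The other odd
  coefficients are inner products of a real and a purely imaginary quaternion, hence 0.\<close>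

lemma normal_poly_qderiv_ijk_poly:
  "normal_poly (qderiv (ijk_poly n)) =
    Poly_Mapping.single (2 * n + 4) (of_nat ((n + 3)\<^sup>2)) +
    Poly_Mapping.single (2 * n + 2) (of_nat (3 * (n + 2)\<^sup>2)) +
    Poly_Mapping.single (2 * n + 1) (- 4) +
    Poly_Mapping.single (2 * n) (of_nat (3 * (n + 1)\<^sup>2)) +
    Poly_Mapping.single (2 * n - 2) (of_nat (n\<^sup>2))"
proof (cases n)
  case 0
  \<comment> \<open>The constant term of P disappears in P', so P' is quadratic and the leading
    coefficient of \<open>cubic\<close> is 0. The truncated exponent \<open>2 * n - 2\<close>
    carries the coefficient 0.\<close>
  let ?b = "2 * Quat 0 (- 1) (- 1) (- 1)" and ?c = "Quat 0 1 (- 1) 1"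
  have c: "3 * qcnj ?b + ?b * qcnj 3 = 0" "3 * qcnj ?c + ?b * qcnj ?b + ?c * qcnj 3 = 12"
    "?b * qcnj ?c + ?c * qcnj ?b = - 4" "?c * qcnj ?c = 3" "3 * qcnj 3 = 9"
    by (simp_all add: quat_eq_iff)
  have "qderiv (ijk_poly n) = cubic 0 0 3 ?b ?c"
    unfolding qderiv_cubic by (simp add: cubic_def 0)
  then show ?thesis
    by (simp add: normal_poly_cubic c 0)
next
  case (Suc m)
  let ?a = "of_nat (m + 4) :: quat" and ?b = "of_nat (m + 3) * Quat 0 (- 1) (- 1) (- 1)"
    and ?c = "of_nat (m + 2) * Quat 0 1 (- 1) 1" and ?e = "of_nat (m + 1) :: quat"
  have c: "?a * qcnj ?a = of_nat ((m + 4)\<^sup>2)" "?a * qcnj ?b + ?b * qcnj ?a = 0"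
    "?a * qcnj ?c + ?b * qcnj ?b + ?c * qcnj ?a = of_nat (3 * (m + 3)\<^sup>2)"
    "?a * qcnj ?e + ?b * qcnj ?c + ?c * qcnj ?b + ?e * qcnj ?a = - 4"
    "?b * qcnj ?e + ?c * qcnj ?c + ?e * qcnj ?b = of_nat (3 * (m + 2)\<^sup>2)"
    "?c * qcnj ?e + ?e * qcnj ?c = 0" "?e * qcnj ?e = of_nat ((m + 1)\<^sup>2)"
    by (simp_all add: quat_eq_iff power2_eq_square algebra_simps)
  have "qderiv (ijk_poly n) = cubic m ?a ?b ?c ?e"
    unfolding qderiv_cubic by (simp add: cubic_def Suc eval_nat_numeral)
  then have "normal_poly (qderiv (ijk_poly n)) =
    Poly_Mapping.single (2 * m + 6) (of_nat ((m + 4)\<^sup>2)) +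
    Poly_Mapping.single (2 * m + 4) (of_nat (3 * (m + 3)\<^sup>2)) +
    Poly_Mapping.single (2 * m + 3) (- 4) +
    Poly_Mapping.single (2 * m + 2) (of_nat (3 * (m + 2)\<^sup>2)) +
    Poly_Mapping.single (2 * m) (of_nat ((m + 1)\<^sup>2))"
    by (simp only: normal_poly_cubic c single_zero add_0_right)
  moreover have "2 * n + 4 = 2 * m + 6" "2 * n + 2 = 2 * m + 4" "2 * n + 1 = 2 * m + 3"
    "2 * n = 2 * m + 2" "2 * n - 2 = 2 * m" "n + 3 = m + 4" "n + 2 = m + 3" "n + 1 = m + 2"
    "n = m + 1" using Suc by simp_all
  ultimately show ?thesis by metis
qed

section \<open>Real parts of the zeros of N(P) and of P'\<close>

lemma qzeros_normal_poly_ijk_poly: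
  assumes "x \<in> qzeros (qX ^ (2 * n) * (qX ^ 2 + 1) ^ 3)"
  shows "qRe x = 0"
proof -
  \<comment> \<open>Evaluation puts the coefficient 3 to the right of the power, the expanded
    identity to the left.\<close>
  have three: "3 * y = y * 3" for y :: quat
    using mult_of_nat_commute[of 3 y] by simp
  have "qeval (qX ^ (2 * n) * (qX ^ 2 + 1) ^ 3) x = x ^ (2 * n) * (x ^ 2 + 1) ^ 3"
    by (simp only: qX_expansion_eq_singles qeval_add qeval_single)
      (simp only: power_times_square_plus_one_cubed three mult_1_right)
  then have "x = 0 \<or> x ^ 2 + 1 = 0"
    using assms by (auto simp: qzeros_def)
  then have "x = 0 \<or> x * x = - 1"
    by (auto simp: power2_eq_square add_eq_0_iff2)
  then show ?thesis
  proof
    assume *: "x * x = - 1"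
    show ?thesis
    proof (rule ccontr)
      assume "qRe x \<noteq> 0"
      \<comment> \<open>The imaginary coordinates of \<open>x * x\<close> are those of x times
        \<open>2 * qRe x\<close>.\<close>
      then have "qIm1 x = 0" "qIm2 x = 0" "qIm3 x = 0"
        using * by (auto simp: quat_eq_iff)
      then have "qRe x * qRe x = - 1"
        using * by (simp add: quat_eq_iff)
      then show False
        using zero_le_square[of "qRe x"] by simp
    qed
  qed simp
qed

text \<open>Multiplied by \<open>X^(2n)\<close>, the polynomial on the left is \<open>X^2\<close>
  times N(P').\<close>

lemma normal_poly_qderiv_complex_zero:
  fixes n :: nat
  obtains z :: complex where "Re z \<noteq> 0"
   "of_nat ((n + 3)\<^sup>2) * z ^ 6 + of_nat (3 * (n + 2)\<^sup>2) * z ^ 4 - 4 * z ^ 3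
      + of_nat (3 * (n + 1)\<^sup>2) * z ^ 2 + of_nat (n\<^sup>2) = 0"
proof -
  \<comment> \<open>For \<open>n = 0\<close> a factor \<open>z^2\<close> is divided out. The
    constant term is thus nonzero in both cases, which excludes the root 0.\<close>
  define p :: "complex poly" where "p = (if n = 0 then [:3, -4, 12, 0, 9:] else
    [:of_nat (n\<^sup>2), 0, of_nat (3 * (n + 1)\<^sup>2), -4, of_nat (3 * (n + 2)\<^sup>2), 0, of_nat ((n + 3)\<^sup>2):])"
  have "\<not> constant (poly p)"
    by (simp add: constant_degree p_def del: of_nat_add of_nat_mult of_nat_power)
  then obtain z where z: "poly p z = 0"
    using fundamental_theorem_of_algebra by blast
  have "z \<noteq> 0" using z by (auto simp: p_def split: if_splits)
  have eq: "of_nat ((n + 3)\<^sup>2) * z ^ 6 + of_nat (3 * (n + 2)\<^sup>2) * z ^ 4 - 4 * z ^ 3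
      + of_nat (3 * (n + 1)\<^sup>2) * z ^ 2 + of_nat (n\<^sup>2) = 0"
    (is "?p = 0")
  proof -
    have "?p = (if n = 0 then z\<^sup>2 else 1) * poly p z"
      by (simp add: p_def algebra_simps eval_nat_numeral)
    then show ?thesis using z by simp
  qed
  have "Re z \<noteq> 0"
  proof
    assume 0: "Re z = 0"
    have "z = \<i> * of_real (Im z)" using 0 by (simp add: complex_eq_iff)
    then obtain y where y: "z = \<i> * of_real y" by blast
    \<comment> \<open>Even powers of iy are real, and -4 (iy)^3 = 4 i y^3.\<close>
    have "4 * y ^ 3 = Im ?p"
      by (simp add: y power_mult_distrib eval_nat_numeral)
    also have "\<dots> = 0"
      unfolding eq by simp
    finally show False using y \<open>z \<noteq> 0\<close> by simp
  qed
  then show thesis using that eq by blast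
qed

lemma qderiv_ijk_poly_zero:
  obtains x where "qRe x \<noteq> 0" "x \<in> qzeros (qderiv (ijk_poly n))"
proof -
  \<comment> \<open>These are the coefficients for which X P' is \<open>X^n\<close> times the sum of
    the \<open>X^k * a k\<close>; the extra factor X covers \<open>n = 0\<close> as well.\<close>
  define a :: "nat \<Rightarrow> quat" where
    "a k = (if k = 0 then of_nat n else if k = 1 then of_nat (n + 1) * Quat 0 1 (- 1) 1
      else if k = 2 then of_nat (n + 2) * Quat 0 (- 1) (- 1) (- 1) else of_nat (n + 3))" for k
  obtain z :: complex where z: "Re z \<noteq> 0"
   "of_nat ((n + 3)\<^sup>2) * z ^ 6 + of_nat (3 * (n + 2)\<^sup>2) * z ^ 4 - 4 * z ^ 3
      + of_nat (3 * (n + 1)\<^sup>2) * z ^ 2 + of_nat (n\<^sup>2) = 0"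
    using normal_poly_qderiv_complex_zero .
  have "(\<Sum>k\<in>{..3}. \<Sum>l\<in>{..3}. of_real (qRe (a k * qcnj (a l))) * z ^ (k + l))
    = of_nat ((n + 3)\<^sup>2) * z ^ 6 + of_nat (3 * (n + 2)\<^sup>2) * z ^ 4 - 4 * z ^ 3
      + of_nat (3 * (n + 1)\<^sup>2) * z ^ 2 + of_nat (n\<^sup>2)"
    by (simp add: a_def eval_nat_numeral algebra_simps)
  then have "(\<Sum>k\<in>{..3}. \<Sum>l\<in>{..3}. of_real (qRe (a k * qcnj (a l))) * z ^ (k + l)) = 0"
    using z(2) by simp
  then obtain x where x: "qRe x = Re z" "(\<Sum>k\<in>{..3}. x ^ k * a k) = 0"
    by (rule quaternionic_zero_of_normal_zero)
  text \<open>The factor \<open>x\<close> absorbs the truncated exponent \<open>n - 1\<close> when \<open>n = 0\<close>.\<close>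
  have e: "x * (x ^ (n - 1) * (of_nat n * 1)) = x ^ n * of_nat n"
    by (cases n) (simp_all add: mult.assoc[symmetric] del: of_nat_Suc)
  have f: "x * (x ^ p * y) = x ^ Suc p * y" "x ^ p * (x ^ q * y) = x ^ (p + q) * y" for p q y
    by (simp_all add: mult.assoc power_add)
  have "(\<Sum>k\<in>{..3}. x ^ k * a k) = of_nat n + x ^ 1 * (of_nat (n + 1) * Quat 0 1 (- 1) 1)
      + x ^ 2 * (of_nat (n + 2) * Quat 0 (- 1) (- 1) (- 1)) + x ^ 3 * (of_nat (n + 3) * 1)"
    by (simp add: a_def eval_nat_numeral del: of_nat_Suc of_nat_add)
  then have "x ^ n * (\<Sum>k\<in>{..3}. x ^ k * a k) = x ^ n * of_nat n
      + x ^ (n + 1) * (of_nat (n + 1) * Quat 0 1 (- 1) 1)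
      + x ^ (n + 2) * (of_nat (n + 2) * Quat 0 (- 1) (- 1) (- 1)) + x ^ (n + 3) * (of_nat (n + 3) * 1)"
    by (simp only: distrib_left f)
  moreover have "x * qeval (qderiv (ijk_poly n)) x = x ^ Suc (n + 2) * (of_nat (n + 3) * 1)
      + x ^ Suc (n + 1) * (of_nat (n + 2) * Quat 0 (- 1) (- 1) (- 1))
      + x ^ Suc n * (of_nat (n + 1) * Quat 0 1 (- 1) 1) + x ^ n * of_nat n"
    unfolding qderiv_cubic qeval_add qeval_single by (simp only: distrib_left e) (simp only: f)
  moreover have "Suc (n + 2) = n + 3" "Suc (n + 1) = n + 2" "Suc n = n + 1" by simp_all
  ultimately have "x * qeval (qderiv (ijk_poly n)) x = x ^ n * (\<Sum>k\<in>{..3}. x ^ k * a k)"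
    by (simp only: ac_simps)
  \<comment> \<open>The real part of x is nonzero, so the factor x can be cancelled.\<close>
  then have "qeval (qderiv (ijk_poly n)) x = 0"
    using x z(1) by auto
  then show thesis
    using that[of x] x z(1) by (simp add: qzeros_def)
qed

section \<open>The odd monomial and the failure of the Gauss-Lucas inclusion\<close>

theorem corollary5:
  fixes d :: nat and P :: qpoly
  assumes "3 \<le> d"
    and "P = qX ^ (d - 3) * (qX - qconst qi) * (qX - qconst qj) * (qX - qconst qk)"
  shows "normal_poly P = qX ^ (2 * d - 6) * (qX ^ 2 + 1) ^ 3 \<and>
    {n \<in> Poly_Mapping.keys (normal_poly (qderiv P)). odd n} = {2 * d - 5} \<and>
    Poly_Mapping.lookup (normal_poly (qderiv P)) (2 * d - 5) = - 4 \<and>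
    \<not> gauss_lucas_poly P"
proof -
  define n where "n = d - 3"
  have d: "2 * d - 6 = 2 * n" "2 * d - 5 = 2 * n + 1" using assms(1) by (auto simp: n_def)
  have P: "P = ijk_poly n"
    using assms(2) product_eq_ijk_poly[of n] by (simp add: n_def)
  have N: "normal_poly P = qX ^ (2 * d - 6) * (qX ^ 2 + 1) ^ 3"
    unfolding P d by (rule normal_poly_ijk_poly)
  have odd: "Poly_Mapping.lookup (normal_poly (qderiv P)) m = (if m = 2 * n + 1 then - 4 else 0)"
    if "odd m" for m
  proof -
    \<comment> \<open>All these exponents are even, including \<open>2 * n - 2\<close> when it is
      truncated to 0.\<close>
    have "m \<noteq> 2 * n + 4" "m \<noteq> 2 * n + 2" "m \<noteq> 2 * n" "m \<noteq> 2 * n - 2"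
      using that by auto
    then show ?thesis
      unfolding P normal_poly_qderiv_ijk_poly by (auto simp: lookup_add lookup_single when_def)
  qed
  have "- 4 \<noteq> (0 :: quat)" by (simp add: quat_eq_iff)
  then have "{m \<in> Poly_Mapping.keys (normal_poly (qderiv P)). odd m} = {2 * n + 1}"
    using odd by (auto simp: in_keys_iff split: if_splits)
  moreover have "\<not> gauss_lucas_poly P"
  proof
    assume "gauss_lucas_poly P"
    then have sub: "qzeros (qderiv P) \<subseteq> convex hull (qzeros (normal_poly P))"
      by (simp add: gauss_lucas_poly_def)
    have "qzeros (normal_poly P) \<subseteq> {x. qRe x = 0}"
      unfolding N d using qzeros_normal_poly_ijk_poly by blast
    moreover have "convex {x. qRe x = 0}"
      by (simp add: convex_def)
    ultimately have "convex hull (qzeros (normal_poly P)) \<subseteq> {x. qRe x = 0}"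
      by (rule hull_minimal)
    then show False
      using sub qderiv_ijk_poly_zero[of n] unfolding P by blast
  qed
  ultimately show ?thesis
    using N odd[of "2 * n + 1"] by (simp add: d)
qed

end
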